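(* For each $n$, let $\mathcal E^n=\{P^n_\theta:\theta\in\Theta\}$ be an experiment generated by $Y^n$, dominated by a $\sigma$-finite measure $\mu$, with log-likelihood $\mathcal L_n(\theta)=\log\frac{dP^n_\theta}{d\mu}(Y^n)$. Let $d$ be a pre-metric and $\ell$ a pseudo-metric on $\Theta$, let $\epsilon_n=(\epsilon_n(\theta),\theta\in\Theta)$ be a family of positive numbers, let $\Theta_n\subset\Theta$ and $\theta_{(1)},\dots,\theta_{(N_n)}$ be as in the context, and let $\pi_n=\frac1{N_n}\sum_{l=1}^{N_n}\delta_{\theta_{(l)}}$ be the associated sieve prior. Assume that there exist constants $C_0,K_0,K_1>0$ and, for every $\theta_0\in\Theta_n$, a $\theta_0$-admissible partition $(\mathcal J_r,\,0\le r\le R_n)$ of $\{1,\dots,N_n\}$ (with associated constant $A$) together with injective maps $j_r:\mathcal J_r\to\mathcal J_0$, $1\le r\le R_n$, such that $$P^n_{\theta_0}\Big(\exists\, r\in\{1,\dots,R_n\},\ \exists\, l\in\mathcal J_r:\ \mathcal L_n(\theta_{(l)})-\mathcal L_n(\theta_{(j_r(l))})>-K_0\,n\,d(\theta_{(l)},\theta_{(j_r(l))})^2\Big)\le C_0\,e^{-K_1n\,\Omega(\epsilon_n(\cdot),\theta_0,\ell)^2}$$ and $$\sum_{r=1}^{R_n}e^{-K_0nu_r^2}\le C_0\,e^{-K_1n\,\Omega(\epsilon_n(\cdot),\theta_0,\ell)^2},\qquad\text{where } u_r=\min\{d(\theta_{(l)},\theta_{(j_r(l))}):\ l\in\mathcal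 J_r\}.$$ Then for all $\theta_0\in\Theta_n$, $$E^n_{\theta_0}\big[P^{\pi_n}\big(\theta:\ell(\theta,\theta_0)>A\,\epsilon_n(\theta_0)\mid Y^n\big)\big]\le 2C_0\,e^{-K_1n\,\Omega(\epsilon_n(\cdot),\theta_0,\ell)^2}.$$
   Context: A pre-metric $d$ on $\Theta$ is a function $d:\Theta\times\Theta\to[0,\infty)$ with $d(\theta,\theta')=0$ iff $\theta=\theta'$ (no symmetry or triangle inequality required). A pseudo-metric $\ell:\Theta\times\Theta\to[0,\infty)$ satisfies the axioms of a metric except that $\ell(\theta,\theta')=0$ is allowed for some $\theta\neq\theta'$. Modulus: $\Omega(\epsilon_n(\cdot),\theta_0,\ell)=\inf\{d(\theta_0,\theta'):\ \ell(\theta_0,\theta')\ge\epsilon_n(\theta_0)+\epsilon_n(\theta'),\ \theta'\in\Theta\}$. Sieve: $(\Theta_n)_{n\ge1}$ is an increasing sequence of subsets of $\Theta$, compact for the topology induced by $\ell$, such that $\Theta_n$ is covered by a finite collection of $N_n$ balls for $\ell$, with centers $\theta_{(1)},\dots,\theta_{(N_n)}$, the ball centered at $\theta_{(l)}$ having radius $\epsilon_n(\theta_{(l)})$ ($N_n$ need not be minimal). Admissible partition: for $\theta_0\in\Theta_n$, a partition $(\mathcal J_r,0\le r\le R_n)$ of $\{1,\dots,N_n\}$ (depending on $\theta_0$) is $\theta_0$-admissible if (i) there exists $A>0$ such that $\mathcal J_0=\{l:\ \ell(\theta_0,\theta_{(l)})\le A\,\epsilon_n(\theta_0)\}$, and (ii)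 $|\mathcal J_r|\le|\mathcal J_0|$ for all $1\le r\le R_n$. $E^n_{\theta}$ is expectation under $P^n_{\theta}$ and $P^{\pi_n}(\cdot\mid Y^n)$ is the posterior distribution for the prior $\pi_n$. *)

theory Defs
  imports "HOL-Probability.Probability"
begin

definition premetric_on :: "'t set \<Rightarrow> ('t \<Rightarrow> 't \<Rightarrow> real) \<Rightarrow> bool" where
  "premetric_on \<Theta> d \<longleftrightarrow>
    (\<forall>\<theta>\<in>\<Theta>. \<forall>\<theta>'\<in>\<Theta>. 0 \<le> d \<theta> \<theta>' \<and> (d \<theta> \<theta>' = 0 \<longleftrightarrow> \<theta> = \<theta>'))"

definition pseudometric_on :: "'t set \<Rightarrow> ('t \<Rightarrow> 't \<Rightarrow> real) \<Rightarrow> bool" where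
  "pseudometric_on \<Theta> \<rho> \<longleftrightarrow>
    (\<forall>\<theta>\<in>\<Theta>. \<rho> \<theta> \<theta> = 0) \<and>
    (\<forall>\<theta>\<in>\<Theta>. \<forall>\<theta>'\<in>\<Theta>. 0 \<le> \<rho> \<theta> \<theta>' \<and> \<rho> \<theta> \<theta>' = \<rho> \<theta>' \<theta>) \<and>
    (\<forall>\<theta>\<in>\<Theta>. \<forall>\<theta>'\<in>\<Theta>. \<forall>\<theta>''\<in>\<Theta>. \<rho> \<theta> \<theta>'' \<le> \<rho> \<theta> \<theta>' + \<rho> \<theta>' \<theta>'')"

definition pseudometric_topology :: "'t set \<Rightarrow> ('t \<Rightarrow> 't \<Rightarrow> real) \<Rightarrow> 't topology" where
  "pseudometric_topology \<Theta> \<rho> =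
    topology_generated_by {{\<theta>'\<in>\<Theta>. \<rho> \<theta> \<theta>' < r} | \<theta> r. \<theta> \<in> \<Theta> \<and> 0 < r}"

text \<open>The infimum is taken in the extended half-line, so that the modulus is infinite when no
  parameter satisfies the constraint.\<close>

definition modulus ::
  "'t set \<Rightarrow> ('t \<Rightarrow> 't \<Rightarrow> real) \<Rightarrow> ('t \<Rightarrow> real) \<Rightarrow> 't \<Rightarrow> ('t \<Rightarrow> 't \<Rightarrow> real) \<Rightarrow> ennreal" where
  "modulus \<Theta> d \<epsilon> \<theta>0 \<rho> =
    (INF \<theta>'\<in>{\<theta>'\<in>\<Theta>. \<rho> \<theta>0 \<theta>' \<ge> \<epsilon> \<theta>0 + \<epsilon> \<theta>'}. ennreal (d \<theta>0 \<theta>'))"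

text \<open>This is \<open>exp (- c * w^2)\<close> for \<open>c > 0\<close> and \<open>w\<close> in the extended half-line.\<close>

definition exp_neg_sq :: "real \<Rightarrow> ennreal \<Rightarrow> real" where
  "exp_neg_sq c w = (if w = \<infinity> then 0 else exp (- c * (enn2real w)\<^sup>2))"

text \<open>Balls are closed, which is the weaker covering requirement. The centers need not be
  distinct and are only required to lie in the parameter set.\<close>

definition sieve ::
  "'t set \<Rightarrow> ('t \<Rightarrow> 't \<Rightarrow> real) \<Rightarrow> (nat \<Rightarrow> 't \<Rightarrow> real) \<Rightarrow> (nat \<Rightarrow> 't set) \<Rightarrow>
   (nat \<Rightarrow> nat) \<Rightarrow> (nat \<Rightarrow> nat \<Rightarrow> 't) \<Rightarrow> bool" where
  "sieve \<Theta> \<rho> \<epsilon> S N c \<longleftrightarrow>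
    mono_on {1..} S \<and>
    (\<forall>n\<ge>1. S n \<subseteq> \<Theta> \<and> compactin (pseudometric_topology \<Theta> \<rho>) (S n) \<and>
       c n ` {1..N n} \<subseteq> \<Theta> \<and>
       S n \<subseteq> (\<Union>l\<in>{1..N n}. {\<theta>\<in>\<Theta>. \<rho> (c n l) \<theta> \<le> \<epsilon> n (c n l)}))"

text \<open>The parts of a partition are nonempty.\<close>

definition admissible_partition ::
  "('t \<Rightarrow> 't \<Rightarrow> real) \<Rightarrow> ('t \<Rightarrow> real) \<Rightarrow> nat \<Rightarrow> (nat \<Rightarrow> 't) \<Rightarrow> 't \<Rightarrow> real \<Rightarrow>
   nat \<Rightarrow> (nat \<Rightarrow> nat set) \<Rightarrow> bool" where
  "admissible_partition \<rho> \<epsilon> N c \<theta>0 A R J \<longleftrightarrow>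
    (\<Union>r\<le>R. J r) = {1..N} \<and> disjoint_family_on J {..R} \<and> (\<forall>r\<le>R. J r \<noteq> {}) \<and>
    0 < A \<and> J 0 = {l\<in>{1..N}. \<rho> \<theta>0 (c l) \<le> A * \<epsilon> \<theta>0} \<and>
    (\<forall>r\<in>{1..R}. card (J r) \<le> card (J 0))"

definition dominated_experiment :: "'t set \<Rightarrow> ('t \<Rightarrow> 'y measure) \<Rightarrow> 'y measure \<Rightarrow> bool" where
  "dominated_experiment \<Theta> P \<mu> \<longleftrightarrow>
    sigma_finite_measure \<mu> \<and>
    (\<forall>\<theta>\<in>\<Theta>. prob_space (P \<theta>) \<and> sets (P \<theta>) = sets \<mu> \<and> absolutely_continuous \<mu> (P \<theta>))"

text \<open>Densities may vanish, so the logarithm takes values in the extended reals.\<close>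

definition ln_ennreal :: "ennreal \<Rightarrow> ereal" where
  "ln_ennreal x = (if x = 0 then -\<infinity> else if x = \<infinity> then \<infinity> else ereal (ln (enn2real x)))"

text \<open>The observation is the canonical one, i.e. the point \<open>y\<close> of the sample space.\<close>

definition log_lik :: "'y measure \<Rightarrow> ('t \<Rightarrow> 'y measure) \<Rightarrow> 't \<Rightarrow> 'y \<Rightarrow> ereal" where
  "log_lik \<mu> P \<theta> y = ln_ennreal (RN_deriv \<mu> (P \<theta>) y)"

text \<open>A difference of log-likelihoods is undefined where both densities vanish. Subtraction of
  extended reals gives \<open>\<infinity>\<close> there, so such observations belong to every event requiring the
  difference to exceed a threshold.\<close>

lemma diff_log_lik_undefined: "(-\<infinity>) - (-\<infinity>) = (\<infinity>::ereal)"
  by simp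

definition sieve_prior :: "nat \<Rightarrow> (nat \<Rightarrow> 't) \<Rightarrow> 't measure" where
  "sieve_prior N c = measure_pmf (map_pmf c (pmf_of_set {1..N}))"

lemma measure_sieve_prior:
  assumes "1 \<le> N"
  shows "measure (sieve_prior N c) B = (1 / real N) * (\<Sum>l=1..N. indicator B (c l))"
proof -
  have "measure (sieve_prior N c) B = real (card ({1..N} \<inter> c -` B)) / real N"
    using assms by (simp add: sieve_prior_def measure_pmf_of_set)
  also have "real (card ({1..N} \<inter> c -` B)) = (\<Sum>l=1..N. indicator (c -` B) l)"
    by (simp add: indicator_def sum.If_cases vimage_def)
  also have "\<dots> = (\<Sum>l=1..N. indicator B (c l))"
    by (intro sum.cong) (auto simp: indicator_def)
  finally show ?thesis by simp
qed

text \<open>Bayes' formula. Where the marginal density vanishes (or is infinite) the posterior is not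
  determined; it is then set to the prior so that it is always a probability measure.\<close>

definition posterior ::
  "'t measure \<Rightarrow> 'y measure \<Rightarrow> ('t \<Rightarrow> 'y measure) \<Rightarrow> 'y \<Rightarrow> 't measure" where
  "posterior \<pi> \<mu> P y =
    (let Z = \<integral>\<^sup>+ \<theta>. RN_deriv \<mu> (P \<theta>) y \<partial>\<pi>
     in if Z = 0 \<or> Z = \<infinity> then \<pi> else density \<pi> (\<lambda>\<theta>. RN_deriv \<mu> (P \<theta>) y / Z))"

end

theory Submission
  imports Defs
begin

text \<open>
  The sieve prior charges finitely many points, so the posterior probability of a set is the
  total likelihood of the centers inside it divided by the total likelihood of all centers.
  The centers at distance more than \<open>A \<epsilon>\<close> from the true parameter are exactly those
  whose index lies in one of the classes \<open>J r\<close> with \<open>r \<ge> 1\<close>.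

  Consider the exceptional event that some center of such a class is too likely compared with its
  partner in \<open>J 0\<close>. Outside this event, each center far from the truth has likelihood at
  most that of its partner times \<open>exp (- K0 n u\<^sub>r\<^sup>2)\<close>. Since the pairing is
  injective on each class, the total likelihood of the class is at most this factor times the total
  likelihood of \<open>J 0\<close> (\<open>sum_le_by_injective_pairing\<close>). Summing over the classes
  bounds the posterior mass far from the truth by
  \<open>\<Sum>\<^sub>r exp (- K0 n u\<^sub>r\<^sup>2)\<close> (\<open>posterior_mass_outside_le\<close>),
  and this is at most \<open>C0 exp (- K1 n \<Omega>\<^sup>2)\<close> by assumption. On the exceptional
  event the posterior mass is at most one, which costs the probability of that event, assumed to be
  at most the same quantity. The two contributions account for the factor two.

  The degenerate cases of Bayes' formula are harmless: an infinite density occurs with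
  probability zero, and a vanishing marginal density can occur outside the exceptional event only
  if \<open>J 0\<close> is the whole index set, since the undefined difference of two infinite
  log-likelihoods counts as exceptional. In that case the prior itself gives no mass to the far set.
\<close>

section \<open>Sums over paired classes\<close>

text \<open>Each class injects into \<open>K\<close>, so it costs at most one copy of the sum over
  \<open>K\<close>.\<close>

lemma sum_le_by_injective_pairing:
  fixes g :: "'a \<Rightarrow> real" and q :: "'i \<Rightarrow> real"
  assumes fin: "finite I" "finite K" "\<And>r. r \<in> I \<Longrightarrow> finite (J r)"
    and g0: "\<And>l. 0 \<le> g l" and q0: "\<And>r. 0 \<le> q r"
    and pairing: "\<And>r. r \<in> I \<Longrightarrow> inj_on (j r) (J r) \<and> j r ` J r \<subseteq> K"
    and le: "\<And>r l. r \<in> I \<Longrightarrow> l \<in> J r \<Longrightarrow> g l \<le> q r * g (j r l)"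
  shows "sum g (\<Union>r\<in>I. J r) \<le> (\<Sum>r\<in>I. q r) * sum g K"
proof -
  have "sum g (\<Union>r\<in>I. J r) = sum g (snd ` Sigma I J)"
    by (intro arg_cong[where f = "sum g"]) force
  also have "\<dots> \<le> sum (g \<circ> snd) (Sigma I J)"
    using fin g0 by (intro sum_image_le) auto
  also have "\<dots> = (\<Sum>r\<in>I. sum g (J r))"
    using fin by (subst sum.Sigma) (auto simp: comp_def case_prod_beta)
  also have "\<dots> \<le> (\<Sum>r\<in>I. q r * sum g K)"
  proof (rule sum_mono)
    fix r assume r: "r \<in> I"
    have "sum g (J r) \<le> (\<Sum>l\<in>J r. q r * g (j r l))"
      using le[OF r] by (rule sum_mono)
    also have "\<dots> = q r * sum g (j r ` J r)"
      using pairing[OF r] by (simp add: sum_distrib_left sum.reindex)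
    also have "\<dots> \<le> q r * sum g K"
      using pairing[OF r] fin g0 q0 by (intro mult_left_mono sum_mono2) auto
    finally show "sum g (J r) \<le> q r * sum g K" .
  qed
  also have "\<dots> = (\<Sum>r\<in>I. q r) * sum g K"
    by (simp add: sum_distrib_right)
  finally show ?thesis .
qed

section \<open>Likelihood ratios in the extended reals\<close>

text \<open>The conventions for differences of infinite values make the first two conclusions
  automatic: a difference with \<open>v = 0\<close> or with \<open>u = \<infinity>\<close> evaluates to
  \<open>\<infinity>\<close>.\<close>

lemma ln_ennreal_diff_leD:
  assumes le: "ln_ennreal u - ln_ennreal v \<le> ereal t"
  shows "v \<noteq> 0" "u \<noteq> \<infinity>"
    and "v \<noteq> \<infinity> \<Longrightarrow> enn2real u \<le> exp t * enn2real v"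
proof -
  show v0: "v \<noteq> 0"
    using le by (cases "ln_ennreal u") (auto simp: ln_ennreal_def)
  show u: "u \<noteq> \<infinity>"
    using le by (auto simp: ln_ennreal_def split: if_splits)
  assume v: "v \<noteq> \<infinity>"
  have vpos: "0 < enn2real v"
    using v v0 by (simp add: enn2real_positive_iff top.not_eq_extremum zero_less_iff_neq_zero)
  show "enn2real u \<le> exp t * enn2real v"
  proof (cases "u = 0")
    case True
    then show ?thesis using vpos by simp
  next
    case False
    then have upos: "0 < enn2real u"
      using u by (simp add: enn2real_positive_iff top.not_eq_extremum zero_less_iff_neq_zero)
    have "ln (enn2real u) - ln (enn2real v) \<le> t"
      using le False u v0 v by (simp add: ln_ennreal_def)
    then have "ln (enn2real u) \<le> ln (exp t * enn2real v)"
      using vpos by (simp add: ln_mult)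
    then show ?thesis using upos vpos by simp
  qed
qed

lemma measurable_ln_ennreal [measurable]: "ln_ennreal \<in> borel_measurable borel"
  unfolding ln_ennreal_def[abs_def] by measurable

lemma measurable_log_lik [measurable]: "log_lik \<mu> P \<theta> \<in> borel_measurable \<mu>"
  unfolding log_lik_def[abs_def] by measurable

section \<open>The posterior of a sieve prior\<close>

lemma nn_integral_sieve_prior:
  assumes "1 \<le> N"
  shows "(\<integral>\<^sup>+ \<theta>. f \<theta> \<partial>sieve_prior N c) = (\<Sum>l=1..N. f (c l)) / ennreal (real N)"
  using assms by (simp add: sieve_prior_def nn_integral_pmf_of_set ennreal_of_nat_eq_real_of_nat)

lemma prob_space_sieve_prior: "prob_space (sieve_prior N c)"
  unfolding sieve_prior_def by (rule measure_pmf.prob_space_axioms)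

lemma sets_sieve_prior [simp]: "sets (sieve_prior N c) = UNIV"
  and space_sieve_prior [simp]: "space (sieve_prior N c) = UNIV"
  by (simp_all add: sieve_prior_def)

lemma measure_posterior_sieve_prior_le_1:
  "measure (posterior (sieve_prior N c) \<mu> P y) B \<le> 1"
proof -
  let ?\<pi> = "sieve_prior N c"
  define Z where "Z = (\<integral>\<^sup>+ \<theta>. RN_deriv \<mu> (P \<theta>) y \<partial>?\<pi>)"
  have m: "h \<in> borel_measurable ?\<pi>" for h :: "'a \<Rightarrow> ennreal"
    by (auto simp: measurable_def)
  have "prob_space (posterior ?\<pi> \<mu> P y)"
  proof (cases "Z = 0 \<or> Z = \<infinity>")
    case True
    then show ?thesis
      by (simp add: posterior_def Z_def[symmetric] prob_space_sieve_prior)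
  next
    case False
    have "emeasure (density ?\<pi> (\<lambda>\<theta>. RN_deriv \<mu> (P \<theta>) y / Z)) UNIV = Z / Z"
      using m by (simp add: emeasure_density nn_integral_divide Z_def)
    then have "prob_space (density ?\<pi> (\<lambda>\<theta>. RN_deriv \<mu> (P \<theta>) y / Z))"
      using False by (intro prob_spaceI) (simp add: ennreal_divide_self less_top)
    then show ?thesis
      using False by (simp add: posterior_def Z_def[symmetric])
  qed
  then show ?thesis by (rule prob_space.prob_le_1)
qed

text \<open>The weights \<open>1 / N\<close> cancel between the numerator and the marginal density.\<close>

lemma measure_posterior_sieve_prior:
  fixes c :: "nat \<Rightarrow> 't" and P :: "'t \<Rightarrow> 'y measure" and \<mu> :: "'y measure" and y :: 'y
  defines "g \<equiv> \<lambda>l. enn2real (RN_deriv \<mu> (P (c l)) y)"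
  assumes N: "1 \<le> N"
    and fin: "\<And>l. l \<in> {1..N} \<Longrightarrow> RN_deriv \<mu> (P (c l)) y \<noteq> \<infinity>"
    and pos: "0 < (\<Sum>l=1..N. g l)"
  shows "measure (posterior (sieve_prior N c) \<mu> P y) B
    = (\<Sum>l\<in>{l\<in>{1..N}. c l \<in> B}. g l) / (\<Sum>l=1..N. g l)"
proof -
  let ?\<pi> = "sieve_prior N c"
  let ?f = "\<lambda>\<theta>. RN_deriv \<mu> (P \<theta>) y"
  define G where "G = (\<Sum>l=1..N. g l)"
  define Z where "Z = (\<integral>\<^sup>+ \<theta>. ?f \<theta> \<partial>?\<pi>)"
  have m: "h \<in> borel_measurable ?\<pi>" for h :: "'t \<Rightarrow> ennreal"
    by (auto simp: measurable_def)
  have g0: "0 \<le> g l" for l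
    by (simp add: g_def)
  have G: "0 < G"
    using pos by (simp add: G_def)
  have f: "?f (c l) = ennreal (g l)" if "l \<in> {1..N}" for l
    using fin[OF that] by (simp add: g_def less_top)
  have "Z = (\<Sum>l=1..N. ennreal (g l)) / ennreal (real N)"
    using N f by (simp add: Z_def nn_integral_sieve_prior)
  also have "\<dots> = ennreal (G / N)"
    using N g0 by (simp add: G_def sum_ennreal divide_ennreal sum_nonneg)
  finally have Z: "Z = ennreal (G / N)" .
  have "emeasure (density ?\<pi> (\<lambda>\<theta>. ?f \<theta> / Z)) B
      = (\<integral>\<^sup>+ \<theta>. ?f \<theta> / Z * indicator B \<theta> \<partial>?\<pi>)"
    using m by (simp add: emeasure_density)
  also have "\<dots> = (\<Sum>l=1..N. ?f (c l) / Z * indicator B (c l)) / ennreal (real N)"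
    using N by (rule nn_integral_sieve_prior)
  also have "(\<Sum>l=1..N. ?f (c l) / Z * indicator B (c l))
      = (\<Sum>l=1..N. ennreal (g l / (G / N) * indicator B (c l)))"
    using N G g0 f by (intro sum.cong) (auto simp: Z divide_ennreal indicator_def)
  also have "\<dots> = ennreal (\<Sum>l=1..N. g l / (G / N) * indicator B (c l))"
    using N G g0 by (intro sum_ennreal) auto
  also have "\<dots> / ennreal (real N)
      = ennreal ((\<Sum>l=1..N. g l / (G / N) * indicator B (c l)) / N)"
    using N G g0 by (intro divide_ennreal sum_nonneg) auto
  also have "(\<Sum>l=1..N. g l / (G / N) * indicator B (c l)) / N
      = (\<Sum>l=1..N. g l * indicator B (c l)) / G"
    unfolding sum_divide_distrib using N by (intro sum.cong) auto
  also have "(\<Sum>l=1..N. g l * indicator B (c l)) = (\<Sum>l\<in>{l\<in>{1..N}. c l \<in> B}. g l)"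
    unfolding sum.inter_filter[OF finite_atLeastAtMost] by (intro sum.cong) auto
  finally have e: "emeasure (density ?\<pi> (\<lambda>\<theta>. ?f \<theta> / Z)) B
      = ennreal ((\<Sum>l\<in>{l\<in>{1..N}. c l \<in> B}. g l) / G)" .
  have "posterior ?\<pi> \<mu> P y = density ?\<pi> (\<lambda>\<theta>. ?f \<theta> / Z)"
    using N G by (simp add: posterior_def Z_def[symmetric]) (simp add: Z)
  then show ?thesis
    unfolding G_def[symmetric] using e G g0 by (simp add: measure_def sum_nonneg)
qed

text \<open>This is the deterministic core: for a fixed observation, likelihood ratios at most
  \<open>exp (t r)\<close> on the class \<open>J r\<close> bound the posterior mass of any set that avoids
  the centers of \<open>J 0\<close>. Nonemptiness of the classes is what rules out a vanishing marginal
  density when there is at least one class besides \<open>J 0\<close>.\<close>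

lemma posterior_mass_outside_le:
  fixes J :: "nat \<Rightarrow> nat set" and t :: "nat \<Rightarrow> real"
  assumes cover: "(\<Union>r\<le>R. J r) = {1..N}"
    and ne: "\<And>r. r \<le> R \<Longrightarrow> J r \<noteq> {}"
    and avoid: "\<And>l. l \<in> J 0 \<Longrightarrow> c l \<notin> B"
    and pairing: "\<And>r. r \<in> {1..R} \<Longrightarrow> inj_on (j r) (J r) \<and> j r ` J r \<subseteq> J 0"
    and fin: "\<And>l. l \<in> {1..N} \<Longrightarrow> RN_deriv \<mu> (P (c l)) y \<noteq> \<infinity>"
    and ratio: "\<And>r l. r \<in> {1..R} \<Longrightarrow> l \<in> J r \<Longrightarrow>
      log_lik \<mu> P (c l) y - log_lik \<mu> P (c (j r l)) y \<le> ereal (t r)"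
  shows "measure (posterior (sieve_prior N c) \<mu> P y) B \<le> (\<Sum>r=1..R. exp (t r))"
proof -
  define g where "g = (\<lambda>l. enn2real (RN_deriv \<mu> (P (c l)) y))"
  define G where "G = (\<Sum>l=1..N. g l)"
  have g0: "0 \<le> g l" for l
    by (simp add: g_def)
  have J: "J r \<subseteq> {1..N}" if "r \<le> R" for r
    using cover that by blast
  then have finJ: "finite (J r)" if "r \<le> R" for r
    using that finite_subset by blast
  have N: "1 \<le> N"
    using J[OF le0] ne[OF le0] by (cases N) auto
  have far: "{l\<in>{1..N}. c l \<in> B} \<subseteq> (\<Union>r\<in>{1..R}. J r)"
  proof
    fix l assume l: "l \<in> {l\<in>{1..N}. c l \<in> B}"
    then obtain r where r: "r \<le> R" "l \<in> J r"
      using cover by blast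
    with l avoid have "r \<noteq> 0" by (cases "r = 0") auto
    with r show "l \<in> (\<Union>r\<in>{1..R}. J r)" by force
  qed
  show ?thesis
  proof (cases "G = 0")
    case True
    then have g_zero: "g l = 0" if "l \<in> {1..N}" for l
      using that g0 by (simp add: G_def sum_nonneg_eq_0_iff)
    then have f_zero: "RN_deriv \<mu> (P (c l)) y = 0" if "l \<in> {1..N}" for l
      using that fin[OF that] by (auto simp: g_def enn2real_eq_0_iff)
    \<comment> \<open>A center in a further class would have a partner of positive density.\<close>
    have "R = 0"
    proof (rule ccontr)
      assume "R \<noteq> 0"
      then have R: "1 \<in> {1..R}" by simp
      then obtain l where l: "l \<in> J 1"
        using ne[of 1] by auto
      have "j 1 l \<in> {1..N}"
        using pairing[OF R] l J[of 0] by blast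
      then show False
        using ln_ennreal_diff_leD(1)[OF ratio[OF R l, unfolded log_lik_def]] f_zero by blast
    qed
    then have "{l\<in>{1..N}. c l \<in> B} = {}"
      using far by simp
    then have "measure (sieve_prior N c) B = 0"
      using N by (simp add: measure_sieve_prior)
    moreover have "posterior (sieve_prior N c) \<mu> P y = sieve_prior N c"
      using N f_zero by (simp add: posterior_def nn_integral_sieve_prior)
    ultimately show ?thesis
      by (simp add: sum_nonneg)
  next
    case False
    then have G: "0 < G"
      using g0 by (simp add: G_def less_le sum_nonneg)
    have le: "g l \<le> exp (t r) * g (j r l)" if r: "r \<in> {1..R}" and l: "l \<in> J r" for r l
    proof -
      have "j r l \<in> {1..N}"
        using pairing[OF r] l J[of 0] by blast
      from ln_ennreal_diff_leD(3)[OF ratio[OF r l, unfolded log_lik_def] fin[OF this]]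
      show ?thesis by (simp add: g_def)
    qed
    have "(\<Sum>l\<in>{l\<in>{1..N}. c l \<in> B}. g l) \<le> sum g (\<Union>r\<in>{1..R}. J r)"
      using far finJ g0 by (intro sum_mono2) auto
    also have "\<dots> \<le> (\<Sum>r=1..R. exp (t r)) * sum g (J 0)"
      using finJ g0 pairing le by (intro sum_le_by_injective_pairing[where j = j]) auto
    also have "\<dots> \<le> (\<Sum>r=1..R. exp (t r)) * G"
      unfolding G_def using J[of 0] g0
      by (intro mult_left_mono sum_mono2 sum_nonneg) auto
    finally have "(\<Sum>l\<in>{l\<in>{1..N}. c l \<in> B}. g l) / G \<le> (\<Sum>r=1..R. exp (t r))"
      using G by (simp add: divide_le_eq)
    then show ?thesis
      using measure_posterior_sieve_prior[where P = P and \<mu> = \<mu> and y = y and c = c and N = N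
          and B = B, OF N fin] G
      unfolding G_def g_def by simp
  qed
qed

section \<open>Concentration of the posterior\<close>

lemma AE_RN_deriv_finite_experiment:
  assumes dom: "dominated_experiment \<Theta> P \<mu>" and "\<theta>0 \<in> \<Theta>" "\<theta> \<in> \<Theta>"
  shows "AE y in P \<theta>0. RN_deriv \<mu> (P \<theta>) y \<noteq> \<infinity>"
proof -
  interpret sigma_finite_measure \<mu>
    using dom by (simp add: dominated_experiment_def)
  have "prob_space (P \<theta>)" "absolutely_continuous \<mu> (P \<theta>)" "sets (P \<theta>) = sets \<mu>"
    using dom \<open>\<theta> \<in> \<Theta>\<close> by (auto simp: dominated_experiment_def)
  then have "AE y in \<mu>. RN_deriv \<mu> (P \<theta>) y \<noteq> \<infinity>"
    by (intro RN_deriv_finite prob_space_imp_sigma_finite)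
  then show ?thesis
    using dom \<open>\<theta>0 \<in> \<Theta>\<close>
    by (intro absolutely_continuous_AE[where M = \<mu> and M' = "P \<theta>0"])
      (auto simp: dominated_experiment_def)
qed

lemma (in prob_space) expectation_le_prob_plus_const:
  assumes B [measurable]: "B \<in> events" and s: "0 \<le> s"
    and le1: "\<And>x. f x \<le> (1::real)"
    and le: "AE x in M. x \<notin> B \<longrightarrow> f x \<le> s"
  shows "expectation f \<le> prob B + s"
proof -
  have "expectation f \<le> expectation (\<lambda>x. indicator B x + s)"
  proof (rule integral_mono_AE')
    show "integrable M (\<lambda>x. indicator B x + s)"
      by (simp add: fmeasurable_def less_top[symmetric])
    show "AE x in M. f x \<le> indicator B x + s"
      using le
    proof eventually_elim
      case (elim x)
      then show ?case using le1[of x] s by (auto simp: indicator_def)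
    qed
    \<comment> \<open>This covers the case that \<open>f\<close> is not integrable and its integral is zero by convention.\<close>
    show "AE x in M. 0 \<le> indicator B x + s"
      using s by simp
  qed
  also have "\<dots> = prob B + s"
    by (simp add: fmeasurable_def less_top[symmetric] prob_space)
  finally show ?thesis .
qed

theorem theorem4p1:
  fixes \<Theta> :: "'t set"
    and P :: "nat \<Rightarrow> 't \<Rightarrow> 'y measure" and \<mu> :: "nat \<Rightarrow> 'y measure"
    and d \<rho> :: "'t \<Rightarrow> 't \<Rightarrow> real"
    and \<epsilon> :: "nat \<Rightarrow> 't \<Rightarrow> real"
    and S :: "nat \<Rightarrow> 't set" and N :: "nat \<Rightarrow> nat" and c :: "nat \<Rightarrow> nat \<Rightarrow> 't"
    and C0 K0 K1 :: real
    and n :: nat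
    and A :: "'t \<Rightarrow> real" and R :: "'t \<Rightarrow> nat" and J :: "'t \<Rightarrow> nat \<Rightarrow> nat set"
    and j :: "'t \<Rightarrow> nat \<Rightarrow> nat \<Rightarrow> nat"
  assumes "\<And>m. m \<ge> 1 \<Longrightarrow> dominated_experiment \<Theta> (P m) (\<mu> m)"
    and "premetric_on \<Theta> d"
    and "pseudometric_on \<Theta> \<rho>"
    and "\<And>m \<theta>. m \<ge> 1 \<Longrightarrow> \<theta> \<in> \<Theta> \<Longrightarrow> 0 < \<epsilon> m \<theta>"
    and "sieve \<Theta> \<rho> \<epsilon> S N c"
    and "n \<ge> 1"
    and "0 < C0" "0 < K0" "0 < K1"
    and "\<And>\<theta>0. \<theta>0 \<in> S n \<Longrightarrow>
      admissible_partition \<rho> (\<epsilon> n) (N n) (c n) \<theta>0 (A \<theta>0) (R \<theta>0) (J \<theta>0)"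
    and "\<And>\<theta>0 r. \<theta>0 \<in> S n \<Longrightarrow> r \<in> {1..R \<theta>0} \<Longrightarrow>
      inj_on (j \<theta>0 r) (J \<theta>0 r) \<and> j \<theta>0 r ` J \<theta>0 r \<subseteq> J \<theta>0 0"
    and "\<And>\<theta>0. \<theta>0 \<in> S n \<Longrightarrow>
      \<P>(y in P n \<theta>0. \<exists>r\<in>{1..R \<theta>0}. \<exists>l\<in>J \<theta>0 r.
          log_lik (\<mu> n) (P n) (c n l) y - log_lik (\<mu> n) (P n) (c n (j \<theta>0 r l)) y
            > ereal (- K0 * real n * (d (c n l) (c n (j \<theta>0 r l)))\<^sup>2))
        \<le> C0 * exp_neg_sq (K1 * real n) (modulus \<Theta> d (\<epsilon> n) \<theta>0 \<rho>)"
    and "\<And>\<theta>0. \<theta>0 \<in> S n \<Longrightarrow>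
      (\<Sum>r=1..R \<theta>0. exp (- K0 * real n *
          (Min ((\<lambda>l. d (c n l) (c n (j \<theta>0 r l))) ` J \<theta>0 r))\<^sup>2))
        \<le> C0 * exp_neg_sq (K1 * real n) (modulus \<Theta> d (\<epsilon> n) \<theta>0 \<rho>)"
  shows "\<forall>\<theta>0\<in>S n.
    prob_space.expectation (P n \<theta>0)
      (\<lambda>y. measure (posterior (sieve_prior (N n) (c n)) (\<mu> n) (P n) y)
             {\<theta>\<in>\<Theta>. \<rho> \<theta> \<theta>0 > A \<theta>0 * \<epsilon> n \<theta>0})
      \<le> 2 * C0 * exp_neg_sq (K1 * real n) (modulus \<Theta> d (\<epsilon> n) \<theta>0 \<rho>)"
proof
  fix \<theta>0 assume \<theta>0: "\<theta>0 \<in> S n"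
  define E where "E = C0 * exp_neg_sq (K1 * real n) (modulus \<Theta> d (\<epsilon> n) \<theta>0 \<rho>)"
  define t where "t = (\<lambda>r. - K0 * real n *
    (Min ((\<lambda>l. d (c n l) (c n (j \<theta>0 r l))) ` J \<theta>0 r))\<^sup>2)"
  define Bad where "Bad = {y \<in> space (P n \<theta>0). \<exists>r\<in>{1..R \<theta>0}. \<exists>l\<in>J \<theta>0 r.
    log_lik (\<mu> n) (P n) (c n l) y - log_lik (\<mu> n) (P n) (c n (j \<theta>0 r l)) y
      > ereal (- K0 * real n * (d (c n l) (c n (j \<theta>0 r l)))\<^sup>2)}"
  let ?F = "{\<theta>\<in>\<Theta>. \<rho> \<theta> \<theta>0 > A \<theta>0 * \<epsilon> n \<theta>0}"
  let ?post = "\<lambda>y. posterior (sieve_prior (N n) (c n)) (\<mu> n) (P n) y"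
  have dom: "dominated_experiment \<Theta> (P n) (\<mu> n)"
    using assms(1) \<open>n \<ge> 1\<close> .
  have \<theta>0_mem: "\<theta>0 \<in> \<Theta>" and centers: "\<And>l. l \<in> {1..N n} \<Longrightarrow> c n l \<in> \<Theta>"
    using assms(5) \<open>n \<ge> 1\<close> \<theta>0 unfolding sieve_def by blast+
  interpret prob_space "P n \<theta>0"
    using dom \<theta>0_mem by (simp add: dominated_experiment_def)
  have adm: "admissible_partition \<rho> (\<epsilon> n) (N n) (c n) \<theta>0 (A \<theta>0) (R \<theta>0) (J \<theta>0)"
    using assms(10) \<theta>0 .
  have cover: "(\<Union>r\<le>R \<theta>0. J \<theta>0 r) = {1..N n}" and ne: "\<And>r. r \<le> R \<theta>0 \<Longrightarrow> J \<theta>0 r \<noteq> {}"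
    and J0: "J \<theta>0 0 = {l\<in>{1..N n}. \<rho> \<theta>0 (c n l) \<le> A \<theta>0 * \<epsilon> n \<theta>0}"
    using adm by (auto simp: admissible_partition_def)
  have J: "J \<theta>0 r \<subseteq> {1..N n}" if "r \<le> R \<theta>0" for r
    using cover that by blast
  have pairing: "\<And>r. r \<in> {1..R \<theta>0} \<Longrightarrow>
      inj_on (j \<theta>0 r) (J \<theta>0 r) \<and> j \<theta>0 r ` J \<theta>0 r \<subseteq> J \<theta>0 0"
    using assms(11) \<theta>0 by blast
  have avoid: "c n l \<notin> ?F" if "l \<in> J \<theta>0 0" for l
    using that J0 \<theta>0_mem centers assms(3) by (force simp: pseudometric_on_def)
  have d_nonneg: "0 \<le> d (c n l) (c n (j \<theta>0 r l))" if "r \<in> {1..R \<theta>0}" "l \<in> J \<theta>0 r" for r l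
  proof -
    have "l \<in> {1..N n}" "j \<theta>0 r l \<in> {1..N n}"
      using that(2) pairing[OF that(1)] J[of r] J[of 0] that(1) atLeastAtMost_iff by blast+
    then show ?thesis
      using centers assms(2) by (simp add: premetric_on_def)
  qed
  have sets_eq: "sets (P n \<theta>0) = sets (\<mu> n)"
    using dom \<theta>0_mem by (simp add: dominated_experiment_def)
  have [measurable]: "log_lik (\<mu> n) (P n) \<theta> \<in> borel_measurable (P n \<theta>0)" for \<theta>
    unfolding measurable_cong_sets[OF sets_eq refl] by (rule measurable_log_lik)
  have fin [simp]: "finite (J \<theta>0 r)" if "r \<in> {1..R \<theta>0}" for r
    using J[of r] that finite_subset by fastforce
  have Bad: "Bad \<in> events"
    unfolding Bad_def by (intro sets.sets_Collect_finite_Ex sets.sets_Collect_countable_Bex) measurable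
  have "AE y in P n \<theta>0. \<forall>l\<in>{1..N n}. RN_deriv (\<mu> n) (P n (c n l)) y \<noteq> \<infinity>"
    using AE_RN_deriv_finite_experiment[OF dom \<theta>0_mem centers]
    by (intro AE_finite_allI) auto
  then have "AE y in P n \<theta>0. y \<notin> Bad \<longrightarrow> measure (?post y) ?F \<le> (\<Sum>r=1..R \<theta>0. exp (t r))"
    using AE_space
  proof eventually_elim
    case (elim y)
    show ?case
    proof
      assume y: "y \<notin> Bad"
      have ratio: "log_lik (\<mu> n) (P n) (c n l) y - log_lik (\<mu> n) (P n) (c n (j \<theta>0 r l)) y
          \<le> ereal (t r)" if r: "r \<in> {1..R \<theta>0}" and l: "l \<in> J \<theta>0 r" for r l
      proof -
        let ?u = "Min ((\<lambda>l. d (c n l) (c n (j \<theta>0 r l))) ` J \<theta>0 r)"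
        have "?u \<in> (\<lambda>l. d (c n l) (c n (j \<theta>0 r l))) ` J \<theta>0 r"
          using r l by (intro Min_in) auto
        then have "0 \<le> ?u"
          using d_nonneg[OF r] by auto
        moreover have "?u \<le> d (c n l) (c n (j \<theta>0 r l))"
          using r l by (intro Min_le) auto
        ultimately have "?u\<^sup>2 \<le> (d (c n l) (c n (j \<theta>0 r l)))\<^sup>2"
          by (intro power_mono)
        then have "- K0 * real n * (d (c n l) (c n (j \<theta>0 r l)))\<^sup>2 \<le> t r"
          using \<open>0 < K0\<close> by (simp add: t_def mult_left_mono)
        moreover have "log_lik (\<mu> n) (P n) (c n l) y - log_lik (\<mu> n) (P n) (c n (j \<theta>0 r l)) y
            \<le> ereal (- K0 * real n * (d (c n l) (c n (j \<theta>0 r l)))\<^sup>2)"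
          using y elim r l unfolding Bad_def not_less[symmetric] by blast
        ultimately show ?thesis
          by (meson ereal_less_eq(3) order_trans)
      qed
      show "measure (?post y) ?F \<le> (\<Sum>r=1..R \<theta>0. exp (t r))"
        using elim(1)
        by (intro posterior_mass_outside_le[OF cover ne avoid pairing _ ratio]) auto
    qed
  qed
  then have "expectation (\<lambda>y. measure (?post y) ?F) \<le> prob Bad + (\<Sum>r=1..R \<theta>0. exp (t r))"
    by (intro expectation_le_prob_plus_const Bad sum_nonneg measure_posterior_sieve_prior_le_1) auto
  also have "\<dots> \<le> E + E"
    using assms(12,13)[OF \<theta>0] unfolding Bad_def t_def E_def by (intro add_mono) auto
  finally show "expectation (\<lambda>y. measure (?post y) ?F)
      \<le> 2 * C0 * exp_neg_sq (K1 * real n) (modulus \<Theta> d (\<epsilon> n) \<theta>0 \<rho>)"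
    by (simp add: E_def)
qed

end
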